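(* Let $G=(V,E)$ be a graph and $t\ge1$ an integer such that the line graph $L(G)$ is $t$-partially walk-regular, and let $L(G)$ have adjacency eigenvalues $\lambda'_1\ge\cdots\ge\lambda'_m$, $m=|E|$. Let $p\in\mathbb{R}_t[x]$ satisfy $\sum_{i=1}^m p(\lambda'_i)=0$ and $|\{j: p(\lambda'_j)>0\}|>0$. Then $$\chi'_t(G)\ \ge\ 1+\frac{|\{j: p(\lambda'_j)<0\}|}{|\{j: p(\lambda'_j)>0\}|}.$$
   Context: All graphs are finite, simple and undirected. The line graph $L(G)$ has vertex set $E$, two edges adjacent iff they share an endpoint. $\chi'_t(G)$ is the least number of colours in a colouring of the edges of $G$ in which any two distinct edges at distance at most $t$ in $L(G)$ get distinct colours (i.e. the chromatic number of $L(G)^t$). A graph with adjacency matrix $A$ is $t$-partially walk-regular if for every $\ell\in\{0,1,\dots,t\}$ the diagonal entry $(A^\ell)_{vv}$ (the number of closed walks of length $\ell$ at $v$) does not depend on the vertex $v$. $\mathbb{R}_t[x]$ denotes the real polynomials of degree at most $t$. *)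

theory Defs
  imports "Jordan_Normal_Form.Char_Poly" "HOL-Library.Extended_Nat"
begin

type_synonym 'a ugraph = "'a set \<times> 'a set set"

abbreviation verts :: "'a ugraph \<Rightarrow> 'a set" where "verts G \<equiv> fst G"
abbreviation edges :: "'a ugraph \<Rightarrow> 'a set set" where "edges G \<equiv> snd G"

definition simple_graph :: "'a ugraph \<Rightarrow> bool" where
  "simple_graph G \<longleftrightarrow> finite (verts G) \<and> (\<forall>e \<in> edges G. e \<subseteq> verts G \<and> card e = 2)"

definition line_graph :: "'a ugraph \<Rightarrow> 'a set ugraph" where
  "line_graph G =
     (edges G, {{e, f} |e f. e \<in> edges G \<and> f \<in> edges G \<and> e \<noteq> f \<and> e \<inter> f \<noteq> {}})"

definition walks :: "'a ugraph \<Rightarrow> 'a \<Rightarrow> 'a \<Rightarrow> 'a list set" where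
  "walks G u v = {xs. xs \<noteq> [] \<and> set xs \<subseteq> verts G \<and> hd xs = u \<and> last xs = v \<and>
                      successively (\<lambda>x y. {x, y} \<in> edges G) xs}"

text \<open>The distance is \<open>\<infinity>\<close> between vertices in different components, as the
  infimum of the empty set.\<close>

definition graph_dist :: "'a ugraph \<Rightarrow> 'a \<Rightarrow> 'a \<Rightarrow> enat" where
  "graph_dist G u v = (INF xs \<in> walks G u v. enat (length xs - 1))"

definition distance_edge_colouring ::
  "nat \<Rightarrow> 'a ugraph \<Rightarrow> nat \<Rightarrow> ('a set \<Rightarrow> nat) \<Rightarrow> bool" where
  "distance_edge_colouring t G k c \<longleftrightarrow>
     c ` edges G \<subseteq> {..<k} \<and>
     (\<forall>e \<in> edges G. \<forall>f \<in> edges G.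
        e \<noteq> f \<longrightarrow> graph_dist (line_graph G) e f \<le> enat t \<longrightarrow> c e \<noteq> c f)"

definition distance_chromatic_index :: "nat \<Rightarrow> 'a ugraph \<Rightarrow> nat" where
  "distance_chromatic_index t G = (LEAST k. \<exists>c. distance_edge_colouring t G k c)"

text \<open>Matrices are indexed by \<open>{0..<n}\<close>, so the vertices are listed in an arbitrary fixed
  order. A different order conjugates the adjacency matrix by a permutation matrix, which
  affects neither of the two notions defined from it below.\<close>

definition vertex_list :: "'a ugraph \<Rightarrow> 'a list" where
  "vertex_list G = (SOME vs. distinct vs \<and> set vs = verts G)"

definition adj_matrix :: "'a ugraph \<Rightarrow> real mat" where
  "adj_matrix G = mat (card (verts G)) (card (verts G))
     (\<lambda>(i, j). if {vertex_list G ! i, vertex_list G ! j} \<in> edges G then 1 else 0)"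

definition partially_walk_regular :: "nat \<Rightarrow> 'a ugraph \<Rightarrow> bool" where
  "partially_walk_regular t G \<longleftrightarrow>
     (\<forall>l \<le> t. \<forall>i < card (verts G). \<forall>j < card (verts G).
        (adj_matrix G ^\<^sub>m l) $$ (i, i) = (adj_matrix G ^\<^sub>m l) $$ (j, j))"

text \<open>\<open>ev 1 \<ge> \<dots> \<ge> ev n\<close> are the adjacency eigenvalues, listed with multiplicity
  (as roots of the characteristic polynomial). Values of \<open>ev\<close> outside \<open>{1..n}\<close> are
  irrelevant.\<close>

definition adjacency_eigenvalues :: "'a ugraph \<Rightarrow> (nat \<Rightarrow> real) \<Rightarrow> bool" where
  "adjacency_eigenvalues G ev \<longleftrightarrow>
     (\<forall>i j. 1 \<le> i \<longrightarrow> i \<le> j \<longrightarrow> j \<le> card (verts G) \<longrightarrow> ev j \<le> ev i) \<and>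
     char_poly (adj_matrix G) = (\<Prod>i = 1..card (verts G). [:- ev i, 1:])"

end

theory Submission
  imports Defs
begin

text \<open>
  Let \<open>A\<close> be the adjacency matrix of the line graph and \<open>M = p(A)\<close>. Partial walk-regularity makes
  the diagonal of \<open>M\<close> constant, hence zero since its trace is zero, and entries of \<open>M\<close> at distance
  more than \<open>t\<close> vanish. So in a colouring with \<open>k\<close> colours, \<open>M\<close> vanishes on every colour class.

  Let \<open>x\<close> lie in the span of the negative eigenvectors of \<open>M\<close>, let \<open>x\<^sub>c\<close> be its restriction to
  colour \<open>c\<close>, and put \<open>y\<^sub>c = k x\<^sub>c - x\<close>. Since \<open>x\<^sub>c\<^sup>T M x\<^sub>c = 0\<close>, the values \<open>y\<^sub>c\<^sup>T M y\<^sub>c\<close> sum to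
  \<open>- k x\<^sup>T M x\<close>. The \<open>y\<^sub>c\<close> sum to zero, so making all of them orthogonal to the positive
  eigenvectors costs only \<open>(k - 1) n\<^sup>+\<close> linear conditions. If \<open>n\<^sup>- > (k - 1) n\<^sup>+\<close>, some nonzero
  \<open>x\<close> meets them; then all \<open>y\<^sub>c\<^sup>T M y\<^sub>c \<le> 0\<close>, so \<open>x\<^sup>T M x \<ge> 0\<close>, a contradiction.
\<close>

section \<open>Homogeneous linear systems and the inertia argument\<close>

text \<open>Gaussian elimination, one equation per induction step: an equation with a nonzero
  coefficient is solved for that unknown and substituted into the others, which removes one equation
  and one unknown.\<close>

lemma homogeneous_system_nontrivial_solution:
  fixes f :: "'i \<Rightarrow> 'j \<Rightarrow> 'a::field"
  assumes "finite I" "finite J" "card I < card J"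
  shows "\<exists>a. (\<exists>j\<in>J. a j \<noteq> 0) \<and> (\<forall>i\<in>I. (\<Sum>j\<in>J. f i j * a j) = 0)"
  using assms
proof (induction I arbitrary: J f rule: finite_induct)
  case empty
  then have "J \<noteq> {}" by auto
  then show ?case by (intro exI[of _ "\<lambda>_. 1"]) auto
next
  case (insert i I)
  show ?case
  proof (cases "\<forall>j\<in>J. f i j = 0")
    case True
    from insert have "card I < card J" by simp
    from insert.IH[OF insert.prems(1) this, of f] True show ?thesis by auto
  next
    case False
    then obtain b where b: "b \<in> J" "f i b \<noteq> 0" by auto
    let ?J = "J - {b}"
    have fin: "finite ?J" and card: "card I < card ?J"
      using insert b by auto
    from insert.IH[OF this, of "\<lambda>h j. f h j - f h b * f i j / f i b"]
    obtain a where a: "\<exists>j\<in>?J. a j \<noteq> 0"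
      "\<forall>h\<in>I. (\<Sum>j\<in>?J. (f h j - f h b * f i j / f i b) * a j) = 0" by blast
    \<comment> \<open>The eliminated unknown \<open>b\<close> gets the value that equation
      \<open>i\<close> forces; the modified coefficients above are those of the other equations
      after this substitution.\<close>
    define a' where "a' = a(b := - (\<Sum>j\<in>?J. f i j * a j) / f i b)"
    have split: "(\<Sum>j\<in>J. f h j * a' j) = f h b * a' b + (\<Sum>j\<in>?J. f h j * a j)" for h
      using insert.prems(1) b(1) by (subst sum.remove[of _ b]) (auto simp: a'_def intro!: sum.cong)
    have "(\<Sum>j\<in>J. f h j * a' j) = 0" if "h \<in> I" for h
    proof -
      have "0 = (\<Sum>j\<in>?J. f h j * a j - f h b / f i b * (f i j * a j))"
        using a(2) that by (auto simp: algebra_simps)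
      also have "\<dots> = (\<Sum>j\<in>J. f h j * a' j)"
        unfolding split sum_subtractf sum_distrib_left[symmetric] by (simp add: a'_def)
      finally show ?thesis by simp
    qed
    moreover have "(\<Sum>j\<in>J. f i j * a' j) = 0"
      unfolding split using b by (simp add: a'_def)
    moreover have "\<exists>j\<in>J. a' j \<noteq> 0" using a(1) by (auto simp: a'_def)
    ultimately show ?thesis by auto
  qed
qed

text \<open>The dimension count of the overview, separated from graphs: the form \<open>M\<close>
  enters only through an orthonormal family diagonalising it and through its vanishing on colour
  classes.\<close>

lemma inertia_colouring_bound:
  fixes M :: "'v \<Rightarrow> 'v \<Rightarrow> real" and u :: "'r \<Rightarrow> 'v \<Rightarrow> real" and col :: "'v \<Rightarrow> nat"
  assumes fin: "finite X" "finite R"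
    and orth: "\<And>r s. r \<in> R \<Longrightarrow> s \<in> R \<Longrightarrow> (\<Sum>i\<in>X. u r i * u s i) = (if r = s then 1 else 0)"
    and M: "\<And>i j. i \<in> X \<Longrightarrow> j \<in> X \<Longrightarrow> M i j = (\<Sum>r\<in>R. \<mu> r * (u r i * u r j))"
    and col: "col ` X \<subseteq> {..<k}" and k: "k > 0"
    and zero: "\<And>i j. i \<in> X \<Longrightarrow> j \<in> X \<Longrightarrow> col i = col j \<Longrightarrow> M i j = 0"
  shows "card {r \<in> R. \<mu> r < 0} \<le> (k - 1) * card {r \<in> R. \<mu> r > 0}"
proof (rule ccontr)
  define N P where "N = {r \<in> R. \<mu> r < 0}" and "P = {r \<in> R. \<mu> r > 0}"
  define q where "q y = (\<Sum>i\<in>X. \<Sum>j\<in>X. M i j * (y i * y j))" for y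
  \<comment> \<open>The vector \<open>y\<^sub>c\<close> of the overview is
    \<open>z c i * x i\<close>: \<open>k\<close> times the indicator of colour \<open>c\<close>,
    minus 1.\<close>
  define z where "z c i = real k * (if col i = c then 1 else 0) - 1" for c i
  have finNP: "finite N" "finite P" using fin by (auto simp: N_def P_def)
  \<comment> \<open>In the coordinates given by \<open>u\<close> the form is diagonal, so signs of
    \<open>q\<close> can be read off from signs of \<open>\<mu>\<close>.\<close>
  have q: "q y = (\<Sum>r\<in>R. \<mu> r * (\<Sum>i\<in>X. u r i * y i)\<^sup>2)" for y
  proof -
    have "q y = (\<Sum>i\<in>X. \<Sum>j\<in>X. \<Sum>r\<in>R. \<mu> r * ((u r i * y i) * (u r j * y j)))"
      unfolding q_def by (intro sum.cong) (auto simp: M sum_distrib_left sum_distrib_right mult_ac)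
    also have "\<dots> = (\<Sum>i\<in>X. \<Sum>r\<in>R. \<Sum>j\<in>X. \<mu> r * ((u r i * y i) * (u r j * y j)))"
      by (intro sum.cong refl sum.swap)
    also have "\<dots> = (\<Sum>r\<in>R. \<Sum>i\<in>X. \<Sum>j\<in>X. \<mu> r * ((u r i * y i) * (u r j * y j)))"
      by (rule sum.swap)
    also have "\<dots> = (\<Sum>r\<in>R. \<mu> r * (\<Sum>i\<in>X. u r i * y i)\<^sup>2)"
      by (simp add: power2_eq_square sum_product) (simp add: sum_distrib_left)
    finally show ?thesis .
  qed
  assume "\<not> ?thesis"
  \<comment> \<open>Unknowns are the coefficients of \<open>x\<close> on \<open>N\<close>; there is
    one equation for each positive index and each colour except the last.\<close>
  then have "card ({..<k - 1} \<times> P) < card N"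
    by (simp add: N_def P_def card_cartesian_product)
  from homogeneous_system_nontrivial_solution[OF _ finNP(1) this,
      of "\<lambda>(c, s) r. \<Sum>i\<in>X. u s i * (z c i * u r i)"] finNP
  obtain a where a: "\<exists>r\<in>N. a r \<noteq> 0"
    and sol: "\<And>c s. c < k - 1 \<Longrightarrow> s \<in> P \<Longrightarrow>
      (\<Sum>r\<in>N. (\<Sum>i\<in>X. u s i * (z c i * u r i)) * a r) = 0"
    by fastforce
  define x where "x i = (\<Sum>r\<in>N. a r * u r i)" for i
  have coeff_x: "(\<Sum>i\<in>X. u r i * x i) = (if r \<in> N then a r else 0)" if r: "r \<in> R" for r
  proof -
    have "(\<Sum>i\<in>X. u r i * x i) = (\<Sum>s\<in>N. a s * (\<Sum>i\<in>X. u r i * u s i))"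
      unfolding x_def sum_distrib_left by (subst sum.swap) (simp add: mult_ac)
    also have "\<dots> = (\<Sum>s\<in>N. a s * (if r = s then 1 else 0))"
      using r by (intro sum.cong) (auto simp: orth N_def)
    also have "\<dots> = (if r \<in> N then a r else 0)"
      using finNP by (simp add: if_distrib[of "\<lambda>x. _ * x"] cong: if_cong)
    finally show ?thesis .
  qed
  \<comment> \<open>The coordinates of \<open>x\<close> vanish outside \<open>N\<close>, so no term
    is positive, and an index with \<open>a r \<noteq> 0\<close> makes one term strictly
    negative.\<close>
  have qx: "q x < 0"
  proof -
    from a obtain r where r: "r \<in> N" "a r \<noteq> 0" by auto
    have "(\<Sum>r\<in>R. \<mu> r * (\<Sum>i\<in>X. u r i * x i)\<^sup>2) < (\<Sum>r\<in>R. 0)"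
    proof (rule sum_strict_mono_ex1)
      show "finite R" by fact
      show "\<forall>r\<in>R. \<mu> r * (\<Sum>i\<in>X. u r i * x i)\<^sup>2 \<le> 0"
        by (auto simp: coeff_x N_def mult_nonpos_nonneg)
      show "\<exists>r\<in>R. \<mu> r * (\<Sum>i\<in>X. u r i * x i)\<^sup>2 < 0"
        using r by (intro bexI[of _ r]) (auto simp: coeff_x N_def mult_neg_pos)
    qed
    then show ?thesis by (simp add: q)
  qed
  have sum_z: "(\<Sum>c<k. z c i) = 0" if "i \<in> X" for i
    using col that by (auto simp: z_def sum_subtractf sum_distrib_left[symmetric] image_subset_iff)
  have orth_P: "(\<Sum>i\<in>X. u s i * (z c i * x i)) = 0" if s: "s \<in> P" and c: "c < k" for c s
  proof -
    have lt: "(\<Sum>i\<in>X. u s i * (z c i * x i)) = 0" if c: "c < k - 1" for c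
    proof -
      have "(\<Sum>i\<in>X. u s i * (z c i * x i)) = (\<Sum>r\<in>N. (\<Sum>i\<in>X. u s i * (z c i * u r i)) * a r)"
        unfolding x_def sum_distrib_left sum_distrib_right by (subst sum.swap) (simp add: mult_ac)
      with sol[OF c s] show ?thesis by simp
    qed
    \<comment> \<open>The omitted colour \<open>k - 1\<close> comes for free: the pairings with
      \<open>u s\<close> sum to zero over all colours, and all the others are already zero.\<close>
    have "(\<Sum>c<k. \<Sum>i\<in>X. u s i * (z c i * x i)) = (\<Sum>i\<in>X. u s i * ((\<Sum>c<k. z c i) * x i))"
      unfolding sum_distrib_left sum_distrib_right by (rule sum.swap)
    also have "\<dots> = 0" by (simp add: sum_z)
    finally have "(\<Sum>c<Suc (k - 1). \<Sum>i\<in>X. u s i * (z c i * x i)) = 0"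
      using k by simp
    then have "(\<Sum>i\<in>X. u s i * (z (k - 1) i * x i)) = 0"
      by (simp add: lt)
    with lt c show ?thesis
      by (cases "c = k - 1") auto
  qed
  have "q (\<lambda>i. z c i * x i) \<le> 0" if "c < k" for c
    unfolding q
  proof (rule sum_nonpos)
    fix r assume r: "r \<in> R"
    show "\<mu> r * (\<Sum>i\<in>X. u r i * (z c i * x i))\<^sup>2 \<le> 0"
    proof (cases "r \<in> P")
      case True
      then show ?thesis using orth_P[OF _ that] by simp
    next
      case False
      with r have "\<mu> r \<le> 0" by (auto simp: P_def)
      then show ?thesis by (simp add: mult_nonpos_nonneg)
    qed
  qed
  then have "(\<Sum>c<k. q (\<lambda>i. z c i * x i)) \<le> 0"
    by (intro sum_nonpos) auto
  also have "(\<Sum>c<k. q (\<lambda>i. z c i * x i)) = - real k * q x"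
  proof -
    \<comment> \<open>The extra \<open>(real k)\<^sup>2\<close> occurs only for pairs of equal
      colour, where \<open>M i j\<close> vanishes; hence every pair may be counted with the factor
      \<open>- real k\<close>.\<close>
    have zz: "(\<Sum>c<k. z c i * z c j) = (if col i = col j then (real k)\<^sup>2 else 0) - real k"
      if "i \<in> X" "j \<in> X" for i j
    proof -
      have "(\<Sum>c<k. z c i * z c j) = (\<Sum>c<k. (if c = col i then real k * z c j else 0) - z c j)"
        by (intro sum.cong) (auto simp: z_def algebra_simps)
      also have "\<dots> = real k * z (col i) j"
        using col that sum_z[of j] by (auto simp: sum_subtractf)
      finally show ?thesis by (auto simp: z_def power2_eq_square algebra_simps)
    qed
    have "(\<Sum>c<k. q (\<lambda>i. z c i * x i))
        = (\<Sum>i\<in>X. \<Sum>c<k. \<Sum>j\<in>X. M i j * ((z c i * x i) * (z c j * x j)))"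
      unfolding q_def by (rule sum.swap)
    also have "\<dots> = (\<Sum>i\<in>X. \<Sum>j\<in>X. \<Sum>c<k. M i j * ((z c i * x i) * (z c j * x j)))"
      by (intro sum.cong refl sum.swap)
    also have "\<dots> = (\<Sum>i\<in>X. \<Sum>j\<in>X. M i j * (x i * x j) * (\<Sum>c<k. z c i * z c j))"
      by (simp add: sum_distrib_left mult_ac)
    also have "\<dots> = (\<Sum>i\<in>X. \<Sum>j\<in>X. - real k * (M i j * (x i * x j)))"
      by (intro sum.cong refl) (auto simp: zz zero)
    finally show ?thesis by (simp add: q_def sum_distrib_left)
  qed
  finally show False using qx k by (simp add: mult_le_0_iff zero_le_mult_iff)
qed

section \<open>Orthogonal diagonalisation of real symmetric matrices\<close>

text \<open>The reflection exchanging \<open>u\<close> and the first unit vector; if they coincide, the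
  denominator vanishes and division by zero correctly yields the identity.\<close>

lemma householder_reflection:
  fixes u :: "nat \<Rightarrow> real"
  assumes n: "n > 0" and u: "(\<Sum>i<n. (u i)\<^sup>2) = 1"
  obtains W where "W \<in> carrier_mat n n" "W\<^sup>T = W" "W * W = 1\<^sub>m n"
    "\<And>i. i < n \<Longrightarrow> W $$ (i, 0) = u i"
proof -
  define w where "w i = u i - (if i = 0 then 1 else 0)" for i
  define s where "s = (\<Sum>i<n. (w i)\<^sup>2)"
  define W where "W = mat n n (\<lambda>(i, j). (if i = j then 1 else 0) - 2 / s * (w i * w j))"
  have W: "W \<in> carrier_mat n n" by (simp add: W_def)
  \<comment> \<open>As \<open>u\<close> is a unit vector, its squared distance from the first unit
    vector is \<open>2 - 2 * u 0\<close>. This is what turns column 0 of the reflection into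
    \<open>u\<close>.\<close>
  have "s = (\<Sum>i<n. (u i)\<^sup>2 + (if i = 0 then 1 - 2 * u i else 0))"
    unfolding s_def by (intro sum.cong) (auto simp: w_def power2_eq_square algebra_simps)
  also have "\<dots> = 2 - 2 * u 0" using n u by (simp add: sum.distrib)
  finally have s: "s = - 2 * w 0" by (simp add: w_def)
  have sym: "W\<^sup>T = W" by (rule eq_matI) (auto simp: W_def)
  have inv: "W * W = 1\<^sub>m n"
  proof (rule eq_matI)
    fix i j assume ij: "i < dim_row (1\<^sub>m n :: real mat)" "j < dim_col (1\<^sub>m n :: real mat)"
    let ?d = "\<lambda>i j. if i = j then 1 else 0 :: real"
    have "(W * W) $$ (i, j)
        = (\<Sum>l<n. (?d i l - 2 / s * (w i * w l)) * (?d l j - 2 / s * (w l * w j)))"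
      using ij by (auto simp: W_def scalar_prod_def atLeast0LessThan)
    also have "\<dots> = (\<Sum>l<n. (if l = i then ?d i j - 2 / s * (w i * w j) else 0)
        - (if l = j then 2 / s * (w i * w j) else 0)
        + (2 / s)\<^sup>2 * (w i * w j) * (w l)\<^sup>2)"
      by (intro sum.cong) (auto simp: power2_eq_square algebra_simps)
    also have "\<dots> = ?d i j - 4 / s * (w i * w j) + (2 / s)\<^sup>2 * (w i * w j) * s"
      using ij by (simp add: sum.distrib sum_subtractf sum_distrib_left[symmetric] s_def)
    also have "\<dots> = ?d i j" by (cases "s = 0") (auto simp: power2_eq_square field_simps)
    finally show "(W * W) $$ (i, j) = 1\<^sub>m n $$ (i, j)" using ij by simp
  qed (use W in auto)
  have col0: "W $$ (i, 0) = u i" if i: "i < n" for i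
  proof (cases "s = 0")
    case True
    then have "w i = 0" using i by (simp add: s_def sum_nonneg_eq_0_iff)
    then show ?thesis using i n True by (auto simp: W_def w_def)
  next
    case False
    then have "2 / s * (w i * w 0) = - w i" by (simp add: s)
    then show ?thesis using i n by (simp add: W_def) (simp add: w_def)
  qed
  from W sym inv col0 show thesis by (rule that)
qed

definition diag_of_list :: "'a::zero list \<Rightarrow> 'a mat" where
  "diag_of_list es = mat (length es) (length es) (\<lambda>(i, j). if i = j then es ! i else 0)"

text \<open>Deflation along the list of roots: a reflection moves a unit eigenvector for the first
  root to the first coordinate, symmetry splits off a 1 by 1 block, and induction treats the rest.
  The witness pair \<open>U\<close>, \<open>U\<^sup>T\<close> encodes orthogonality, and the
  eigenvalues keep the order of the list.\<close>

theorem real_symmetric_spectral: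
  fixes A :: "real mat"
  assumes "A \<in> carrier_mat n n" "A\<^sup>T = A" "char_poly A = (\<Prod>e\<leftarrow>es. [:- e, 1:])"
  shows "\<exists>U. similar_mat_wit A (diag_of_list es) U U\<^sup>T"
  using assms
proof (induction es arbitrary: n A)
  case Nil
  with degree_monic_char_poly[OF Nil(1)] have A: "A \<in> carrier_mat 0 0" by auto
  then show ?case
    by (intro exI[of _ "1\<^sub>m 0"] similar_mat_witI[of _ _ 0]) (auto simp: diag_of_list_def)
next
  case (Cons e es n A)
  note A = Cons.prems(1)
  have "n = length (e # es)"
    using degree_monic_char_poly[OF A] degree_linear_factors[of uminus "e # es"] Cons.prems(3) by simp
  then obtain n1 where n1: "n = Suc n1" "n1 = length es" by simp
  have "eigenvalue A e"
    unfolding eigenvalue_root_char_poly[OF A] Cons.prems(3) by simp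
  then obtain v where v: "v \<in> carrier_vec n" "v \<noteq> 0\<^sub>v n" "A *\<^sub>v v = e \<cdot>\<^sub>v v"
    using A by (auto simp: eigenvalue_def eigenvector_def)
  define S where "S = (\<Sum>i<n. (v $ i)\<^sup>2)"
  have "S \<noteq> 0"
    using v(1,2) by (auto simp: S_def sum_nonneg_eq_0_iff intro!: eq_vecI)
  moreover have "S \<ge> 0" by (simp add: S_def sum_nonneg)
  ultimately have S: "S > 0" by simp
  define u where "u i = v $ i / sqrt S" for i
  have "(\<Sum>i<n. (u i)\<^sup>2) = 1"
    using S by (simp add: u_def power_divide sum_divide_distrib[symmetric]) (simp add: S_def)
  then obtain W where W: "W \<in> carrier_mat n n" "W\<^sup>T = W" "W * W = 1\<^sub>m n"
    and W0: "\<And>i. i < n \<Longrightarrow> W $$ (i, 0) = u i"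
    using householder_reflection[of n u] n1 by auto
  have n: "0 < n" using n1 by simp
  have colW: "col W 0 = (1 / sqrt S) \<cdot>\<^sub>v v"
    using W(1) v(1) n W0 by (intro eq_vecI) (auto simp: u_def)
  define A' where "A' = W * A * W"
  have A': "A' \<in> carrier_mat n n" using A W by (simp add: A'_def)
  have sim: "similar_mat_wit A A' W W"
  proof (rule similar_mat_witI[OF W(3) W(3) _ A A' W(1) W(1)])
    have "W * A' * W = (W * W) * A * (W * W)"
      using A W(1) by (simp add: A'_def assoc_mult_mat[of _ n n _ n _ n])
    then show "A = W * A' * W" using A W by simp
  qed
  have symA': "A'\<^sup>T = A'"
    using A W Cons.prems(2)
    by (simp add: A'_def transpose_mult[of _ n n _ n] assoc_mult_mat[of _ n n _ n _ n])
  \<comment> \<open>\<open>W\<close> sends the first unit vector to the normalised eigenvector,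
    \<open>A\<close> scales that by \<open>e\<close>, and \<open>W\<close>, being its own inverse,
    sends it back.\<close>
  have "col A' 0 = W *\<^sub>v (A *\<^sub>v col W 0)"
    unfolding A'_def assoc_mult_mat[OF W(1) A W(1)]
      col_mult2[OF W(1) mult_carrier_mat[OF A W(1)] n] col_mult2[OF A W(1) n] ..
  also have "A *\<^sub>v col W 0 = e \<cdot>\<^sub>v col W 0"
    unfolding colW using A v by (simp add: mult_mat_vec[of _ n n] smult_smult_assoc mult.commute)
  also have "W *\<^sub>v (e \<cdot>\<^sub>v col W 0) = e \<cdot>\<^sub>v col (W * W) 0"
    unfolding col_mult2[OF W(1) W(1) n] by (rule mult_mat_vec[OF W(1)]) (use W(1) n in auto)
  finally have col0: "col A' 0 = e \<cdot>\<^sub>v unit_vec n 0"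
    using n by (simp add: W(3))
  have A'0: "A' $$ (i, 0) = (if i = 0 then e else 0)" if "i < n" for i
    using arg_cong[OF col0, of "\<lambda>v. v $ i"] that n A' by auto
  have A'0': "A' $$ (0, i) = (if i = 0 then e else 0)" if "i < n" for i
    using arg_cong[OF symA', of "\<lambda>M. M $$ (0, i)"] A'0[OF that] that n A' by auto
  define A3 where "A3 = mat n1 n1 (\<lambda>(i, j). A' $$ (Suc i, Suc j))"
  let ?E = "mat 1 1 (\<lambda>_. e)"
  have A3: "A3 \<in> carrier_mat n1 n1" by (simp add: A3_def)
  \<comment> \<open>The first column is known from the eigenvector, the first row from
    symmetry.\<close>
  have block: "A' = four_block_mat ?E (0\<^sub>m 1 n1) (0\<^sub>m n1 1) A3"
    using A' n1 A'0 A'0' by (intro eq_matI) (auto simp: A3_def)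
  have symA3: "A3\<^sup>T = A3"
  proof (rule eq_matI)
    fix i j assume ij: "i < dim_row A3" "j < dim_col A3"
    then have "A' $$ (Suc j, Suc i) = A' $$ (Suc i, Suc j)"
      using arg_cong[OF symA', of "\<lambda>M. M $$ (Suc i, Suc j)"] A' n1 A3 by auto
    then show "A3\<^sup>T $$ (i, j) = A3 $$ (i, j)" using ij A3 by (simp add: A3_def)
  qed (use A3 in auto)
  have "similar_mat A A'" using sim by (auto simp: similar_mat_def)
  then have "[:- e, 1:] * (\<Prod>e\<leftarrow>es. [:- e, 1:]) = char_poly A'"
    using char_poly_similar Cons.prems(3) by fastforce
  also have "\<dots> = char_poly ?E * char_poly A3"
    unfolding block by (rule char_poly_four_block_zeros_col) (use A3 in auto)
  also have "char_poly ?E = [:- e, 1:]"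
    by (simp add: char_poly_defs det_def sign_def)
  \<comment> \<open>Cancelling the nonzero factor \<open>[:- e, 1:]\<close> leaves the remaining
    roots for the induction hypothesis.\<close>
  finally have "char_poly A3 = (\<Prod>e\<leftarrow>es. [:- e, 1:])"
    by (metis mult_cancel_left pCons_eq_0_iff zero_neq_one)
  from Cons.IH[OF A3 symA3 this] obtain U
    where U: "similar_mat_wit A3 (diag_of_list es) U U\<^sup>T" by blast
  have Uc: "U \<in> carrier_mat n1 n1" using similar_mat_witD2[OF A3 U] by simp
  let ?U = "four_block_mat (1\<^sub>m 1) (0\<^sub>m 1 n1) (0\<^sub>m n1 1) U"
  have "similar_mat_wit A' (four_block_mat ?E (0\<^sub>m 1 n1) (0\<^sub>m n1 1) (diag_of_list es))
      ?U (four_block_mat (1\<^sub>m 1) (0\<^sub>m 1 n1) (0\<^sub>m n1 1) U\<^sup>T)"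
    unfolding block
    by (rule similar_mat_wit_four_block[OF similar_mat_wit_refl[of _ 1] U]) (use Uc A3 in auto)
  also have "four_block_mat ?E (0\<^sub>m 1 n1) (0\<^sub>m n1 1) (diag_of_list es) = diag_of_list (e # es)"
    by (rule eq_matI) (auto simp: diag_of_list_def n1 nth_Cons')
  also have "four_block_mat (1\<^sub>m 1) (0\<^sub>m 1 n1) (0\<^sub>m n1 1) U\<^sup>T = ?U\<^sup>T"
    using Uc by (simp add: transpose_four_block_mat[of _ 1 1 _ n1 _ n1])
  finally have "similar_mat_wit A' (diag_of_list (e # es)) ?U ?U\<^sup>T" .
  from similar_mat_wit_trans[OF sim this]
  have "similar_mat_wit A (diag_of_list (e # es)) (W * ?U) (?U\<^sup>T * W)" .
  moreover have "?U\<^sup>T * W = (W * ?U)\<^sup>T"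
    using W n1 Uc by (subst transpose_mult[of _ n n _ n]) auto
  ultimately show ?case by auto
qed

lemma diag_of_list_pow:
  fixes es :: "'a::comm_semiring_1 list"
  shows "diag_of_list es ^\<^sub>m l = diag_of_list (map (\<lambda>e. e ^ l) es)"
proof (induction l)
  case 0
  show ?case by (rule eq_matI) (auto simp: diag_of_list_def)
next
  case (Suc l)
  show ?case unfolding pow_mat.simps Suc
  proof (rule eq_matI)
    fix i j assume "i < dim_row (diag_of_list (map (\<lambda>e. e ^ Suc l) es))"
      "j < dim_col (diag_of_list (map (\<lambda>e. e ^ Suc l) es))"
    then have ij: "i < length es" "j < length es" by (auto simp: diag_of_list_def)
    have "(diag_of_list (map (\<lambda>e. e ^ l) es) * diag_of_list es) $$ (i, j)
        = (\<Sum>h<length es. if h = i then (if i = j then es ! i ^ Suc l else 0) else 0)"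
    proof -
      have "(diag_of_list (map (\<lambda>e. e ^ l) es) * diag_of_list es) $$ (i, j)
          = (\<Sum>h<length es. diag_of_list (map (\<lambda>e. e ^ l) es) $$ (i, h) * diag_of_list es $$ (h, j))"
        using ij by (simp add: diag_of_list_def scalar_prod_def atLeast0LessThan)
      also have "\<dots> = (\<Sum>h<length es. if h = i then (if i = j then es ! i ^ Suc l else 0) else 0)"
        using ij by (intro sum.cong) (auto simp: diag_of_list_def mult.commute)
      finally show ?thesis .
    qed
    then show "(diag_of_list (map (\<lambda>e. e ^ l) es) * diag_of_list es) $$ (i, j)
        = diag_of_list (map (\<lambda>e. e ^ Suc l) es) $$ (i, j)"
      using ij by (simp add: diag_of_list_def)
  qed (auto simp: diag_of_list_def)
qed

text \<open>The vectors \<open>u r\<close> are the columns of the diagonalising \<open>U\<close>: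
  orthonormality is \<open>U\<^sup>T * U = 1\<close>, and the entry formula is the l-th power of the
  diagonalisation. Entrywise sums are the form that the inertia argument takes.\<close>

lemma real_symmetric_orthonormal_eigenbasis:
  fixes A :: "real mat"
  assumes A: "A \<in> carrier_mat n n" "A\<^sup>T = A"
    and cp: "char_poly A = (\<Prod>r<n. [:- \<theta> r, 1:])"
  obtains u where
    "\<And>r s. r < n \<Longrightarrow> s < n \<Longrightarrow> (\<Sum>i<n. u r i * u s i) = (if r = s then 1 else 0)"
    "\<And>l i j. i < n \<Longrightarrow> j < n \<Longrightarrow> (A ^\<^sub>m l) $$ (i, j) = (\<Sum>r<n. \<theta> r ^ l * (u r i * u r j))"
proof -
  let ?es = "map \<theta> [0..<n]"
  have "char_poly A = (\<Prod>e\<leftarrow>?es. [:- e, 1:])"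
    unfolding cp by (simp add: prod.list_conv_set_nth atLeast0LessThan o_def)
  from real_symmetric_spectral[OF A this] obtain U
    where U: "similar_mat_wit A (diag_of_list ?es) U U\<^sup>T" by blast
  note D = similar_mat_witD2[OF A(1) U]
  show thesis
  proof (rule that[of "\<lambda>r i. U $$ (i, r)"])
    fix r s assume rs: "r < n" "s < n"
    have "(\<Sum>i<n. U $$ (i, r) * U $$ (i, s)) = (U\<^sup>T * U) $$ (r, s)"
      using D(6) rs by (auto simp: scalar_prod_def atLeast0LessThan)
    then show "(\<Sum>i<n. U $$ (i, r) * U $$ (i, s)) = (if r = s then 1 else 0)"
      using D(2) rs by simp
  next
    fix l i j assume ij: "i < n" "j < n"
    let ?D = "diag_of_list (map (\<lambda>e. e ^ l) ?es)"
    have "(U * ?D) $$ (i, r) = \<theta> r ^ l * U $$ (i, r)" if r: "r < n" for r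
    proof -
      have "(U * ?D) $$ (i, r) = (\<Sum>h<n. U $$ (i, h) * ?D $$ (h, r))"
        using D(6) ij r by (simp add: diag_of_list_def scalar_prod_def atLeast0LessThan)
      also have "\<dots> = (\<Sum>h<n. if h = r then \<theta> r ^ l * U $$ (i, r) else 0)"
        using r by (intro sum.cong) (auto simp: diag_of_list_def)
      finally show ?thesis using r by simp
    qed
    then have "(U * ?D * U\<^sup>T) $$ (i, j) = (\<Sum>r<n. \<theta> r ^ l * (U $$ (i, r) * U $$ (j, r)))"
      using D(6) ij
      by (simp add: diag_of_list_def index_mult_mat(1)[of _ "U * _"] scalar_prod_def
          atLeast0LessThan mult_ac del: index_mult_mat(1))
    then show "(A ^\<^sub>m l) $$ (i, j) = (\<Sum>r<n. \<theta> r ^ l * (U $$ (i, r) * U $$ (j, r)))"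
      using similar_mat_wit_pow_id[OF U, of l] by (simp add: diag_of_list_pow)
  qed
qed

section \<open>Powers of the adjacency matrix, walks and distance\<close>

lemma vertex_list:
  assumes "finite (verts G)"
  shows "distinct (vertex_list G)" "set (vertex_list G) = verts G"
  using someI_ex[of "\<lambda>vs. distinct vs \<and> set vs = verts G"] finite_distinct_list[OF assms]
  by (auto simp: vertex_list_def)

lemma length_vertex_list: "finite (verts G) \<Longrightarrow> length (vertex_list G) = card (verts G)"
  using vertex_list[of G] distinct_card by fastforce

lemma adj_matrix_carrier: "adj_matrix G \<in> carrier_mat (card (verts G)) (card (verts G))"
  by (simp add: adj_matrix_def)

lemma transpose_adj_matrix: "(adj_matrix G)\<^sup>T = adj_matrix G"
  by (rule eq_matI) (auto simp: adj_matrix_def insert_commute)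

text \<open>Splitting off the last factor of the power, a nonzero entry has a nonzero summand, that
  is, a shorter walk followed by an edge. A walk with \<open>l\<close> edges is a list of
  \<open>Suc l\<close> vertices.\<close>

lemma adj_matrix_pow_nonzero_imp_walk:
  assumes fin: "finite (verts G)" and i: "i < card (verts G)" and j: "j < card (verts G)"
    and "(adj_matrix G ^\<^sub>m l) $$ (i, j) \<noteq> 0"
  shows "\<exists>xs \<in> walks G (vertex_list G ! i) (vertex_list G ! j). length xs = Suc l"
  using j assms(4)
proof (induction l arbitrary: j)
  case 0
  then have "i = j" using i by (auto simp: adj_matrix_def split: if_splits)
  moreover have "vertex_list G ! j \<in> verts G"
    using vertex_list(2)[OF fin] length_vertex_list[OF fin] 0 nth_mem by metis
  ultimately show ?case
    by (intro bexI[of _ "[vertex_list G ! i]"]) (auto simp: walks_def)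
next
  case (Suc l)
  let ?n = "card (verts G)" and ?A = "adj_matrix G" and ?v = "\<lambda>i. vertex_list G ! i"
  note A = adj_matrix_carrier[of G]
  have "(?A ^\<^sub>m Suc l) $$ (i, j) = (\<Sum>h<?n. (?A ^\<^sub>m l) $$ (i, h) * ?A $$ (h, j))"
    using A pow_carrier_mat[OF A, of l] i Suc.prems(1)
    by (simp add: scalar_prod_def atLeast0LessThan)
  with Suc.prems(2) obtain h where h: "h < ?n" "(?A ^\<^sub>m l) $$ (i, h) \<noteq> 0" "?A $$ (h, j) \<noteq> 0"
    by (metis (no_types, lifting) lessThan_iff mult_eq_0_iff sum.neutral)
  from Suc.IH[OF h(1,2)] obtain xs where xs: "xs \<in> walks G (?v i) (?v h)" "length xs = Suc l"
    by blast
  have "{?v h, ?v j} \<in> edges G"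
    using h Suc.prems(1) by (auto simp: adj_matrix_def split: if_splits)
  moreover have "?v j \<in> verts G"
    using vertex_list(2)[OF fin] length_vertex_list[OF fin] Suc.prems(1) nth_mem by metis
  ultimately have "xs @ [?v j] \<in> walks G (?v i) (?v j)"
    using xs(1) by (auto simp: walks_def successively_append_iff)
  then show ?case using xs(2) by (intro bexI[of _ "xs @ [?v j]"]) auto
qed

text \<open>A nonzero entry would give a walk with \<open>l\<close> edges and so bound the distance
  by \<open>l\<close>. Infinite distance is covered as well.\<close>

lemma adj_matrix_pow_zero_beyond_distance:
  assumes "finite (verts G)" "i < card (verts G)" "j < card (verts G)"
    and "enat l < graph_dist G (vertex_list G ! i) (vertex_list G ! j)"
  shows "(adj_matrix G ^\<^sub>m l) $$ (i, j) = 0"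
proof (rule ccontr)
  assume "\<not> ?thesis"
  from adj_matrix_pow_nonzero_imp_walk[OF assms(1-3) this] obtain xs
    where "xs \<in> walks G (vertex_list G ! i) (vertex_list G ! j)" "length xs = Suc l" by blast
  then have "graph_dist G (vertex_list G ! i) (vertex_list G ! j) \<le> enat l"
    unfolding graph_dist_def by (intro INF_lower2[of xs]) auto
  with assms(4) show False by simp
qed

section \<open>The bound for distance colourings of vertices\<close>

text \<open>Eigenvalues are numbered from 1, the eigenbasis from 0; this translates the
  counts.\<close>

lemma card_filter_atLeast1_atMost_eq:
  "card {j \<in> {1..m}. P j} = card {r \<in> {..<m}. P (Suc r)}"
proof -
  have "{j \<in> {1..m}. P j} = Suc ` {r \<in> {..<m}. P (Suc r)}"
    by (auto simp: image_iff Suc_le_eq gr0_conv_Suc)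
  then show ?thesis by (simp add: card_image)
qed

text \<open>Holds for vertex colourings of any finite graph; edge colourings are the case of a line
  graph. The matrix \<open>M\<close> is \<open>p\<close> evaluated at the adjacency matrix, and the
  work is to show that it vanishes on colour classes.\<close>

theorem distance_colouring_inertia_bound:
  assumes fin: "finite (verts G)" and n: "n = card (verts G)"
    and reg: "partially_walk_regular t G"
    and ev: "adjacency_eigenvalues G ev"
    and deg: "degree p \<le> t"
    and trace: "(\<Sum>i = 1..n. poly p (ev i)) = 0"
    and col: "c ` verts G \<subseteq> {..<k}" and k: "k > 0"
    and proper: "\<And>u v. u \<in> verts G \<Longrightarrow> v \<in> verts G \<Longrightarrow> u \<noteq> v \<Longrightarrow>
      graph_dist G u v \<le> enat t \<Longrightarrow> c u \<noteq> c v"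
  shows "card {j \<in> {1..n}. poly p (ev j) < 0} \<le> (k - 1) * card {j \<in> {1..n}. poly p (ev j) > 0}"
proof -
  let ?A = "adj_matrix G" and ?v = "\<lambda>i. vertex_list G ! i"
  define \<mu> where "\<mu> r = poly p (ev (Suc r))" for r
  define M where "M i j = (\<Sum>l\<le>degree p. coeff p l * (?A ^\<^sub>m l) $$ (i, j))" for i j
  have "char_poly ?A = (\<Prod>r<n. [:- ev (Suc r), 1:])"
    using ev by (simp add: adjacency_eigenvalues_def n prod.atLeast1_atMost_eq)
  then obtain u where
    orth: "\<And>r s. r < n \<Longrightarrow> s < n \<Longrightarrow> (\<Sum>i<n. u r i * u s i) = (if r = s then 1 else 0)" and
    pow: "\<And>l i j. i < n \<Longrightarrow> j < n \<Longrightarrow>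
      (?A ^\<^sub>m l) $$ (i, j) = (\<Sum>r<n. ev (Suc r) ^ l * (u r i * u r j))"
    by (rule real_symmetric_orthonormal_eigenbasis[OF adj_matrix_carrier[of G, folded n]
          transpose_adj_matrix]) blast
  have M: "M i j = (\<Sum>r<n. \<mu> r * (u r i * u r j))" if "i < n" "j < n" for i j
  proof -
    have "M i j = (\<Sum>l\<le>degree p. \<Sum>r<n. coeff p l * ev (Suc r) ^ l * (u r i * u r j))"
      using that by (simp add: M_def pow sum_distrib_left mult_ac)
    also have "\<dots> = (\<Sum>r<n. \<Sum>l\<le>degree p. coeff p l * ev (Suc r) ^ l * (u r i * u r j))"
      by (rule sum.swap)
    finally show ?thesis by (simp add: \<mu>_def poly_altdef sum_distrib_right)
  qed
  have diag: "M i i = 0" if i: "i < n" for i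
  proof -
    have "M j j = M i i" if "j < n" for j
    proof -
      have "(?A ^\<^sub>m l) $$ (j, j) = (?A ^\<^sub>m l) $$ (i, i)" if "l \<le> degree p" for l
        using reg[unfolded partially_walk_regular_def, folded n] i \<open>j < n\<close> le_trans[OF that deg] by blast
      then show ?thesis unfolding M_def by (intro sum.cong) auto
    qed
    \<comment> \<open>The diagonal is constant, so \<open>n\<close> times an entry is the trace of
      \<open>M\<close>, which is the sum of the values \<open>\<mu> r\<close> and hence
      zero.\<close>
    then have "(\<Sum>j<n. M j j) = (\<Sum>j<n. M i i)" by (intro sum.cong) auto
    then have "real n * M i i = (\<Sum>j<n. M j j)" by simp
    also have "\<dots> = (\<Sum>j<n. \<Sum>r<n. \<mu> r * (u r j * u r j))" by (simp add: M)
    also have "\<dots> = (\<Sum>r<n. \<Sum>j<n. \<mu> r * (u r j * u r j))" by (rule sum.swap)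
    also have "\<dots> = (\<Sum>r<n. \<mu> r)" by (simp add: sum_distrib_left[symmetric] orth)
    also have "\<dots> = 0" using trace by (simp add: \<mu>_def sum.atLeast1_atMost_eq)
    finally show ?thesis using i by simp
  qed
  have verts: "?v i \<in> verts G" if "i < n" for i
    using vertex_list(2)[OF fin] length_vertex_list[OF fin] that nth_mem n by metis
  have zero: "M i j = 0" if ij: "i < n" "j < n" "c (?v i) = c (?v j)" for i j
  proof (cases "i = j")
    case False
    then have "?v i \<noteq> ?v j"
      using ij vertex_list(1)[OF fin] length_vertex_list[OF fin] n by (simp add: nth_eq_iff_index_eq)
    \<comment> \<open>Distinct vertices of one colour are further than \<open>t\<close> apart, and
      \<open>t\<close> bounds the degree of \<open>p\<close>, so every power occurring in
      \<open>M\<close> has a zero entry here.\<close>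
    then have "enat t < graph_dist G (?v i) (?v j)"
      using proper[OF verts verts, of i j] ij by force
    then have "(?A ^\<^sub>m l) $$ (i, j) = 0" if "l \<le> degree p" for l
      using adj_matrix_pow_zero_beyond_distance[OF fin] ij n that deg
      by (meson enat_ord_simps(1) le_less_trans le_trans)
    then show ?thesis by (simp add: M_def)
  qed (use diag ij in simp)
  have "card {r \<in> {..<n}. \<mu> r < 0} \<le> (k - 1) * card {r \<in> {..<n}. \<mu> r > 0}"
  proof (rule inertia_colouring_bound[of "{..<n}" "{..<n}" u M \<mu> "\<lambda>i. c (?v i)"])
    show "(\<lambda>i. c (?v i)) ` {..<n} \<subseteq> {..<k}" using col verts by blast
  qed (simp_all only: finite_lessThan lessThan_iff orth M[symmetric] zero k)
  then show ?thesis unfolding card_filter_atLeast1_atMost_eq \<mu>_def .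
qed

section \<open>Transfer to edge colourings through the line graph\<close>

text \<open>The minimum is attained because some colouring exists: the edge set is finite, and
  giving all edges different colours is always proper.\<close>

lemma distance_chromatic_index_colouring:
  assumes "simple_graph G"
  obtains c where "distance_edge_colouring t G (distance_chromatic_index t G) c"
proof -
  have "edges G \<subseteq> Pow (verts G)" "finite (verts G)"
    using assms by (auto simp: simple_graph_def)
  then have "finite (edges G)" by (meson finite_Pow_iff finite_subset)
  from finite_imp_inj_to_nat_seg[OF this] obtain f :: "'a set \<Rightarrow> nat" and k
    where "f ` edges G = {i. i < k}" "inj_on f (edges G)" by blast
  then have "distance_edge_colouring t G k f"
    by (auto simp: distance_edge_colouring_def inj_on_def)
  then have "\<exists>k c. distance_edge_colouring t G k c" by blast
  from LeastI_ex[OF this] obtain c where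
    "distance_edge_colouring t G (distance_chromatic_index t G) c"
    unfolding distance_chromatic_index_def by blast
  then show thesis by (rule that)
qed

theorem theorem3p2:
  fixes V :: "'a set" and E :: "'a set set" and t m :: nat
    and ev :: "nat \<Rightarrow> real" and p :: "real poly"
  assumes "simple_graph (V, E)"
    and "t \<ge> 1"
    and "partially_walk_regular t (line_graph (V, E))"
    and "m = card E"
    and "adjacency_eigenvalues (line_graph (V, E)) ev"
    and "degree p \<le> t"
    and "(\<Sum>i = 1..m. poly p (ev i)) = 0"
    and "card {j \<in> {1..m}. poly p (ev j) > 0} > 0"
  shows "real (distance_chromatic_index t (V, E)) \<ge>
           1 + real (card {j \<in> {1..m}. poly p (ev j) < 0})
             / real (card {j \<in> {1..m}. poly p (ev j) > 0})"
proof -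
  let ?k = "distance_chromatic_index t (V, E)" and ?L = "line_graph (V, E)"
  let ?N = "card {j \<in> {1..m}. poly p (ev j) < 0}" and ?P = "card {j \<in> {1..m}. poly p (ev j) > 0}"
  have verts: "verts ?L = E" by (simp add: line_graph_def)
  \<comment> \<open>A positive value of \<open>p\<close> at some eigenvalue forces an edge to exist,
    and nonzero cardinality also yields finiteness.\<close>
  have "m \<noteq> 0" using assms(8) by (intro notI) simp
  then have E: "finite E" "E \<noteq> {}"
    unfolding assms(4) card_eq_0_iff by simp_all
  obtain c where c: "distance_edge_colouring t (V, E) ?k c"
    using distance_chromatic_index_colouring[OF assms(1)] .
  then have "c ` E \<subseteq> {..<?k}" by (simp add: distance_edge_colouring_def)
  \<comment> \<open>Some edge needs a colour below \<open>?k\<close>; so the truncated difference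
    \<open>?k - 1\<close> is the true one.\<close>
  with E(2) have k: "?k > 0" by (cases ?k) auto
  have "?N \<le> (?k - 1) * ?P"
  \<comment> \<open>The vertices of \<open>?L\<close> are the edges in \<open>E\<close>, so the
    distance edge colouring is a vertex colouring of \<open>?L\<close> of the required kind.\<close>
  proof (rule distance_colouring_inertia_bound[OF _ _ assms(3,5,6,7) _ k])
    show "c ` verts ?L \<subseteq> {..<?k}"
      using c by (simp add: verts distance_edge_colouring_def)
    show "c e \<noteq> c f" if "e \<in> verts ?L" "f \<in> verts ?L" "e \<noteq> f" "graph_dist ?L e f \<le> enat t" for e f
      using c that by (simp add: verts distance_edge_colouring_def)
  qed (simp_all only: verts E assms(4))
  then have "real ?N \<le> real (?k - 1) * real ?P"
    unfolding of_nat_mult[symmetric] of_nat_le_iff .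
  moreover have "real ?P > 0" using assms(8) unfolding of_nat_0_less_iff .
  ultimately have "real ?N / real ?P \<le> real (?k - 1)"
    unfolding pos_divide_le_eq[OF \<open>real ?P > 0\<close>] by blast
  also have "real (?k - 1) = real ?k - 1"
    using k by (simp only: of_nat_diff Suc_leI One_nat_def of_nat_Suc of_nat_0 add_0)
  finally show ?thesis by (simp only: le_diff_eq add.commute)
qed

end
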